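(* Let $d\ge 1$ be an integer, let $\varepsilon>0$ be a real number, and let $\mathcal{F}$ be a family of $n\ge 1$ axis-parallel boxes in $\mathbb{R}^d$. If at least $\left(\frac{d-1}{2d}+\varepsilon\right)n^2$ pairs of elements of $\mathcal{F}$ intersect, then $\mathcal{F}$ contains an intersecting subfamily of size at least $dn\varepsilon-\frac d2+1$.
   Context: An axis-parallel box (or box) in $\mathbb{R}^d$ is a product of $d$ bounded intervals, either all open, $(a_1,b_1)\times\cdots\times(a_d,b_d)$, or all closed, $[a_1,b_1]\times\cdots\times[a_d,b_d]$, with $a_i<b_i$ for all $i$. The statement holds both when the boxes of the family are open and when they are closed. A subfamily is intersecting if there is a point of $\mathbb{R}^d$ belonging to all of its elements; a pair of boxes intersects if the two boxes have nonempty intersection. Pairs are unordered pairs of elements of $\mathcal{F}$. *)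

theory Defs
  imports "HOL-Analysis.Analysis"
begin

definition open_box :: "(real ^ 'd) set \<Rightarrow> bool" where
  "open_box B \<longleftrightarrow> (\<exists>a b. (\<forall>i. a $ i < b $ i) \<and> B = box a b)"

definition closed_box :: "(real ^ 'd) set \<Rightarrow> bool" where
  "closed_box B \<longleftrightarrow> (\<exists>a b. (\<forall>i. a $ i < b $ i) \<and> B = cbox a b)"

text \<open>All members of a family are of the same kind: open and closed boxes are never mixed.\<close>

definition box_family :: "(real ^ 'd) set set \<Rightarrow> bool" where
  "box_family F \<longleftrightarrow> (\<forall>B\<in>F. open_box B) \<or> (\<forall>B\<in>F. closed_box B)"

definition intersecting :: "'a set set \<Rightarrow> bool" where
  "intersecting G \<longleftrightarrow> (\<exists>x. \<forall>B\<in>G. x \<in> B)"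

text \<open>Unordered pairs of distinct members; a box is not paired with itself.\<close>

definition intersecting_pairs :: "'a set set \<Rightarrow> 'a set set set" where
  "intersecting_pairs F = {{A, B} | A B. A \<in> F \<and> B \<in> F \<and> A \<noteq> B \<and> A \<inter> B \<noteq> {}}"

end

theory Submission
  imports Defs
begin

text \<open>
  The number of intersecting pairs is bounded by peeling off \<open>d\<close> boxes at a time.
  In each coordinate \<open>i\<close> pick a box \<open>B\<^sub>i\<close> whose upper endpoint \<open>b\<^sub>i\<close> is smallest, and
  enlarge \<open>{B\<^sub>1, \<dots>, B\<^sub>d}\<close> to a set \<open>D\<close> of exactly \<open>d\<close> boxes.  In coordinate \<open>i\<close> a box
  that meets \<open>B\<^sub>i\<close> does not start after \<open>b\<^sub>i\<close> and, by the choice of \<open>B\<^sub>i\<close>, does not end before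
  \<open>b\<^sub>i\<close>; hence the boxes that meet every member of \<open>D\<close> all contain one common point, near the corner \<open>(b\<^sub>1, \<dots>, b\<^sub>d)\<close>
  (\<open>boxes_meeting_transversal\<close>).

  Let \<open>k\<close> be the largest size of an intersecting subfamily. Every box outside \<open>D\<close> meets at most
  \<open>d - 1\<close> members of \<open>D\<close>, except for the boxes through the common point. If \<open>D\<close> is pairwise
  intersecting then its members are themselves among the at most \<open>k\<close> boxes through
  that point, and otherwise a pair inside \<open>D\<close> is missing. In either case the deletion of \<open>D\<close>
  destroys at most \<open>d(d - 1)/2 + (d - 1)(n - d) + (k - 1)\<close> pairs (\<open>card_pairs_peel\<close>).
  The function \<open>(d - 1)n\<^sup>2/(2d) + (k - 1)n/d\<close> of \<open>n\<close> has exactly these increments, so it bounds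
  the number of intersecting pairs (\<open>card_pairs_bound\<close>). Comparison with the assumed number of
  pairs gives \<open>k \<ge> d n \<epsilon> + 1\<close>.
\<close>

section \<open>Boxes that meet all members of a small subfamily\<close>

text \<open>
  Open and closed boxes share the following abstract description: a box is a product of the
  sets \<open>I B i\<close>, and among two boxes the one with the larger \<open>u\<close> reaches at
  least as far up in coordinate \<open>i\<close>.
\<close>

lemma ordered_products_meeting_transversal:
  fixes F :: "(real ^ 'd) set set" and I :: "(real ^ 'd) set \<Rightarrow> 'd \<Rightarrow> real set"
    and u :: "(real ^ 'd) set \<Rightarrow> 'd \<Rightarrow> real"
  assumes fin: "finite F" and card: "CARD('d) \<le> card F"
    and prod: "\<And>B x. B \<in> F \<Longrightarrow> x \<in> B \<longleftrightarrow> (\<forall>i. x $ i \<in> I B i)"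
    and reach: "\<And>A B i s t. A \<in> F \<Longrightarrow> B \<in> F \<Longrightarrow> u B i \<le> u A i \<Longrightarrow> s \<in> I A i \<Longrightarrow> t \<in> I B i
                  \<Longrightarrow> s \<le> t \<Longrightarrow> t \<in> I A i"
  shows "\<exists>D\<subseteq>F. card D = CARD('d) \<and> intersecting {A \<in> F. \<forall>B\<in>D. A \<inter> B \<noteq> {}}"
proof -
  have ne: "F \<noteq> {}"
    using card zero_less_card_finite[where 'a = 'd] by force
  have "\<exists>B\<in>F. \<forall>A\<in>F. u B i \<le> u A i" for i
  proof -
    have "Min ((\<lambda>B. u B i) ` F) \<in> (\<lambda>B. u B i) ` F"
      using fin ne by (intro Min_in) auto
    then obtain B where B: "B \<in> F" "u B i = Min ((\<lambda>B. u B i) ` F)" by auto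
    have "u B i \<le> u A i" if "A \<in> F" for A
      unfolding B(2) using fin that by (intro Min_le) auto
    with B(1) show ?thesis by blast
  qed
  then obtain b where bF: "\<And>i. b i \<in> F" and bmin: "\<And>i A. A \<in> F \<Longrightarrow> u (b i) i \<le> u A i"
    by metis
  \<comment> \<open>One box may be extremal in several coordinates, hence the padding to exactly \<open>d\<close> boxes.\<close>
  have "card (range b) \<le> CARD('d)" "range b \<subseteq> F"
    using card_image_le[of UNIV b] bF by auto
  then obtain D where D: "range b \<subseteq> D" "D \<subseteq> F" "card D = CARD('d)"
    using exists_subset_between[OF _ card _ fin] by metis
  define S where "S = {A \<in> F. \<forall>B\<in>D. A \<inter> B \<noteq> {}}"
  have finS: "finite S" using fin by (simp add: S_def)
  have "intersecting S"
  proof (cases "S = {}")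
    case False
    have "\<exists>y. y \<in> A \<and> y \<in> b i" if "A \<in> S" for A i
      using that D(1) unfolding S_def by blast
    then obtain y where y: "\<And>A i. A \<in> S \<Longrightarrow> y A i \<in> A" "\<And>A i. A \<in> S \<Longrightarrow> y A i \<in> b i"
      by metis
    \<comment> \<open>The corner formed by the smallest upper endpoints does not belong to open boxes.
       The largest coordinate of a witness for a pair \<open>A\<close>, \<open>b i\<close> replaces it: it lies in the
       interval of \<open>b i\<close> and above a point of every box in \<open>S\<close>.\<close>
    define p :: "real ^ 'd" where "p = (\<chi> i. Max ((\<lambda>A. y A i $ i) ` S))"
    have "p \<in> A" if A: "A \<in> S" for A
    proof -
      have AF: "A \<in> F" using A by (simp add: S_def)
      have "p $ i \<in> I A i" for i
      proof -
        have "Max ((\<lambda>A. y A i $ i) ` S) \<in> (\<lambda>A. y A i $ i) ` S"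
          using finS False by (intro Max_in) auto
        then obtain C where C: "C \<in> S" "p $ i = y C i $ i" by (auto simp: p_def)
        have "p $ i \<in> I (b i) i"
          using y(2)[OF C(1)] prod[OF bF] C(2) by simp
        moreover have "y A i $ i \<in> I A i" using y(1)[OF A] prod[OF AF] by simp
        moreover have "y A i $ i \<le> p $ i"
          using finS A by (simp add: p_def)
        ultimately show ?thesis using reach[OF AF bF bmin[OF AF]] by blast
      qed
      then show ?thesis using prod[OF AF] by simp
    qed
    then show ?thesis by (auto simp: intersecting_def)
  qed (simp add: intersecting_def)
  then show ?thesis using D unfolding S_def by blast
qed

lemma boxes_meeting_transversal:
  fixes F :: "(real ^ 'd) set set"
  assumes "finite F" "CARD('d) \<le> card F" "box_family F"
  shows "\<exists>D\<subseteq>F. card D = CARD('d) \<and> intersecting {A \<in> F. \<forall>B\<in>D. A \<inter> B \<noteq> {}}"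
  using assms(3) unfolding box_family_def
proof
  assume "\<forall>B\<in>F. open_box B"
  then obtain l u where "\<And>B. B \<in> F \<Longrightarrow> B = box (l B) (u B)"
    unfolding open_box_def by metis
  then have mem: "x \<in> B \<longleftrightarrow> (\<forall>i. x $ i \<in> {l B $ i <..< u B $ i})" if "B \<in> F" for B x
    using that mem_box_cart(1)[of x "l B" "u B"] by simp
  show ?thesis
    by (rule ordered_products_meeting_transversal[OF assms(1,2),
          where I = "\<lambda>B i. {l B $ i <..< u B $ i}" and u = "\<lambda>B i. u B $ i"])
      (use mem in auto)
next
  assume "\<forall>B\<in>F. closed_box B"
  then obtain l u where "\<And>B. B \<in> F \<Longrightarrow> B = cbox (l B) (u B)"
    unfolding closed_box_def by metis
  then have mem: "x \<in> B \<longleftrightarrow> (\<forall>i. x $ i \<in> {l B $ i .. u B $ i})" if "B \<in> F" for B x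
    using that mem_box_cart(2)[of x "l B" "u B"] by simp
  show ?thesis
    by (rule ordered_products_meeting_transversal[OF assms(1,2),
          where I = "\<lambda>B i. {l B $ i .. u B $ i}" and u = "\<lambda>B i. u B $ i"])
      (use mem in auto)
qed

lemma box_family_nonempty:
  fixes F :: "(real ^ 'd) set set"
  assumes "box_family F" "B \<in> F"
  shows "B \<noteq> {}"
proof -
  obtain a b :: "real ^ 'd" where ab: "\<forall>i. a $ i < b $ i" "B = box a b \<or> B = cbox a b"
    using assms unfolding box_family_def open_box_def closed_box_def by metis
  then have "box a b \<noteq> {}" by (simp add: interval_ne_empty_cart)
  then show ?thesis using ab(2) box_subset_cbox[of a b] by blast
qed

section \<open>Counting intersecting pairs\<close>

lemma intersecting_pairs_subset:
  "intersecting_pairs F \<subseteq> {P. P \<subseteq> F \<and> card P = 2}"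
  by (auto simp: intersecting_pairs_def card_2_iff)

lemma card_intersecting_pairs_le_choose:
  assumes "finite F"
  shows "card (intersecting_pairs F) \<le> card F choose 2"
  using card_mono[OF _ intersecting_pairs_subset[of F]] n_subsets[OF assms, of 2] assms by simp

lemma card_intersecting_pairs_less_choose:
  assumes "finite F" "A \<in> F" "B \<in> F" "A \<noteq> B" "A \<inter> B = {}"
  shows "card (intersecting_pairs F) < card F choose 2"
proof -
  have "{A, B} \<notin> intersecting_pairs F"
    using assms(5) by (auto simp: intersecting_pairs_def doubleton_eq_iff)
  moreover have "{A, B} \<in> {P. P \<subseteq> F \<and> card P = 2}" using assms by auto
  ultimately have "intersecting_pairs F \<subset> {P. P \<subseteq> F \<and> card P = 2}"
    using intersecting_pairs_subset[of F] by blast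
  then show ?thesis
    using psubset_card_mono[of "{P. P \<subseteq> F \<and> card P = 2}"] n_subsets[OF assms(1), of 2] assms(1)
    by simp
qed

lemma card_intersecting_pairs_split:
  assumes "finite F" "D \<subseteq> F"
  shows "card (intersecting_pairs F) \<le> card (intersecting_pairs (F - D))
           + card (intersecting_pairs D) + (\<Sum>A\<in>F - D. card {B \<in> D. A \<inter> B \<noteq> {}})"
proof -
  have finD: "finite D" using assms by (rule rev_finite_subset)
  define X where "X = (SIGMA A:F - D. {B \<in> D. A \<inter> B \<noteq> {}})"
  have finX: "finite X" using assms(1) finD by (auto simp: X_def)
  have finP: "finite (intersecting_pairs H)" if "finite H" for H :: "'a set set"
    by (rule finite_subset[OF intersecting_pairs_subset]) (use that in simp)
  have "intersecting_pairs F \<subseteq>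
      intersecting_pairs (F - D) \<union> intersecting_pairs D \<union> (\<lambda>(A, B). {A, B}) ` X"
  proof
    fix P assume "P \<in> intersecting_pairs F"
    then obtain A B where AB: "P = {A, B}" "A \<in> F" "B \<in> F" "A \<noteq> B" "A \<inter> B \<noteq> {}"
      by (auto simp: intersecting_pairs_def)
    consider "A \<notin> D" "B \<notin> D" | "A \<in> D" "B \<in> D" | "(A, B) \<in> X" | "(B, A) \<in> X"
      using AB by (auto simp: X_def)
    then show "P \<in> intersecting_pairs (F - D) \<union> intersecting_pairs D \<union> (\<lambda>(A, B). {A, B}) ` X"
    proof cases
      case 1
      then show ?thesis using AB unfolding intersecting_pairs_def by blast
    next
      case 2
      then show ?thesis using AB unfolding intersecting_pairs_def by blast
    next
      case 3
      then show ?thesis using AB(1) by force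
    next
      case 4
      then show ?thesis using AB(1) by (force simp: insert_commute)
    qed
  qed
  then have "card (intersecting_pairs F) \<le>
      card (intersecting_pairs (F - D) \<union> intersecting_pairs D \<union> (\<lambda>(A, B). {A, B}) ` X)"
    using finP assms(1) finD finX by (intro card_mono) auto
  also have "\<dots> \<le> card (intersecting_pairs (F - D)) + card (intersecting_pairs D) + card X"
    using card_image_le[OF finX, of "\<lambda>(A, B). {A, B}"]
    by (meson add_mono card_Un_le le_trans order_refl)
  also have "card X = (\<Sum>A\<in>F - D. card {B \<in> D. A \<inter> B \<noteq> {}})"
    using assms(1) finD by (simp add: X_def)
  finally show ?thesis .
qed

text \<open>
  The lost pairs lie inside \<open>D\<close> or join \<open>D\<close> to a set outside it; such a set meets at most \<open>d - 1\<close>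
  members of \<open>D\<close>, or all \<open>d\<close> of them if it lies in the intersecting subfamily \<open>S\<close>. The saving
  of one pair, the \<open>+ 1\<close> on the left, has two sources: either \<open>D \<subseteq> S\<close>, and then at most
  \<open>k - d\<close> sets outside \<open>D\<close> lie in \<open>S\<close>, or some pair inside \<open>D\<close> is disjoint.
\<close>

lemma card_pairs_peel:
  fixes F :: "'a set set"
  assumes fin: "finite F" and ne: "{} \<notin> F"
    and D: "D \<subseteq> F" "card D = d" "d \<ge> 1"
    and S: "intersecting {A \<in> F. \<forall>B\<in>D. A \<inter> B \<noteq> {}}"
    and max: "\<And>G. G \<subseteq> F \<Longrightarrow> intersecting G \<Longrightarrow> card G \<le> k"
  shows "card (intersecting_pairs F) + 1 \<le>
           card (intersecting_pairs (F - D)) + (d choose 2) + (card F - d) * (d - 1) + k"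
proof -
  have finD: "finite D" using D(1) fin by (rule finite_subset)
  define S where "S = {A \<in> F. \<forall>B\<in>D. A \<inter> B \<noteq> {}}"
  have finS: "finite S" and SF: "S \<subseteq> F" using fin by (auto simp: S_def)
  have Sk: "card S \<le> k" using max[OF SF] S by (simp add: S_def)
  have deg: "card {B \<in> D. A \<inter> B \<noteq> {}} \<le> (d - 1) + (if A \<in> S then 1 else 0)"
    if "A \<in> F - D" for A
  proof (cases "A \<in> S")
    case True
    then show ?thesis using card_mono[OF finD, of "{B \<in> D. A \<inter> B \<noteq> {}}"] D by auto
  next
    case False
    then have "{B \<in> D. A \<inter> B \<noteq> {}} \<subset> D" using that by (auto simp: S_def)
    then have "card {B \<in> D. A \<inter> B \<noteq> {}} < d" using psubset_card_mono[OF finD] D(2) by blast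
    then show ?thesis using False by simp
  qed
  have "(\<Sum>A\<in>F - D. card {B \<in> D. A \<inter> B \<noteq> {}})
          \<le> (\<Sum>A\<in>F - D. (d - 1) + (if A \<in> S then 1 else 0))"
    using deg by (rule sum_mono)
  also have "\<dots> = (card F - d) * (d - 1) + card (S - D)"
  proof -
    have "(\<Sum>A\<in>F - D. if A \<in> S then 1 else 0) = card ((F - D) \<inter> S)"
      using fin sum.inter_restrict[of "F - D" "\<lambda>_. 1::nat" S] by simp
    also have "(F - D) \<inter> S = S - D" using SF by blast
    finally show ?thesis
      using card_Diff_subset[OF finD D(1)] D(2) by (simp only: sum.distrib sum_constant of_nat_id)
  qed
  finally have cross: "(\<Sum>A\<in>F - D. card {B \<in> D. A \<inter> B \<noteq> {}})
      \<le> (card F - d) * (d - 1) + card (S - D)" .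
  have "card (intersecting_pairs D) + card (S - D) + 1 \<le> (d choose 2) + k"
  proof (cases "D \<subseteq> S")
    case True
    have "card (S - D) = card S - d"
      using card_Diff_subset[OF finD True] D(2) by simp
    moreover have "d \<le> card S" using card_mono[OF finS True] D(2) by simp
    ultimately show ?thesis
      using card_intersecting_pairs_le_choose[OF finD, unfolded D(2)] D(3) Sk by linarith
  next
    case False
    then obtain A B where AB: "A \<in> D" "B \<in> D" "A \<inter> B = {}"
      using D(1) by (auto simp: S_def)
    moreover from this have "A \<noteq> B" using D(1) ne by auto
    ultimately have "card (intersecting_pairs D) < d choose 2"
      using card_intersecting_pairs_less_choose[OF finD] D(2) by blast
    moreover have "card (S - D) \<le> k"
      using card_mono[OF finS, of "S - D"] Sk by auto
    ultimately show ?thesis by linarith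
  qed
  then show ?thesis using card_intersecting_pairs_split[OF fin D(1)] cross by linarith
qed

text \<open>
  When the family grows by \<open>d\<close> sets, the right-hand side grows by exactly \<open>2d\<close> times the bound on
  the loss in one peeling step. For the remainder of fewer than \<open>d\<close> sets it is at least
  \<open>2d\<close> times the number of all pairs, intersecting or not.
\<close>

lemma card_pairs_bound:
  fixes F :: "'a set set" and d k :: nat
  assumes "finite F" "{} \<notin> F" "d \<ge> 1" "k \<ge> 1"
    and "\<And>H. H \<subseteq> F \<Longrightarrow> d \<le> card H \<Longrightarrow>
           \<exists>D\<subseteq>H. card D = d \<and> intersecting {A \<in> H. \<forall>B\<in>D. A \<inter> B \<noteq> {}}"
    and "\<And>G. G \<subseteq> F \<Longrightarrow> intersecting G \<Longrightarrow> card G \<le> k"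
  shows "2 * real d * real (card (intersecting_pairs F))
           \<le> (real d - 1) * (real (card F))\<^sup>2 + 2 * (real k - 1) * real (card F)"
  using assms
proof (induction "card F" arbitrary: F rule: less_induct)
  case less
  note fin = less.prems(1)
  have choose2: "real (m choose 2) = real m * (real m - 1) / 2" for m
    by (cases m) (auto simp: choose_two real_of_nat_div algebra_simps)
  show ?case
  proof (cases "d \<le> card F")
    case False
    define n where "n = real (card F)"
    have "real (card (intersecting_pairs F)) \<le> n * (n - 1) / 2"
      using card_intersecting_pairs_le_choose[OF fin] choose2[of "card F"]
      unfolding n_def by (metis of_nat_le_iff)
    then have "2 * real d * real (card (intersecting_pairs F)) \<le> 2 * real d * (n * (n - 1) / 2)"
      by (intro mult_left_mono) auto
    also have "\<dots> = (real d - 1) * n\<^sup>2 + n * (n - real d)"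
      by (simp add: field_simps power2_eq_square)
    also have "\<dots> \<le> (real d - 1) * n\<^sup>2 + 2 * (real k - 1) * n"
    proof -
      have "n * (n - real d) \<le> 0"
        using False by (intro mult_nonneg_nonpos) (auto simp: n_def)
      moreover have "0 \<le> 2 * (real k - 1) * n" using less.prems(4) by (simp add: n_def)
      ultimately show ?thesis by linarith
    qed
    finally show ?thesis unfolding n_def .
  next
    case True
    then obtain D where D: "D \<subseteq> F" "card D = d"
        "intersecting {A \<in> F. \<forall>B\<in>D. A \<inter> B \<noteq> {}}"
      using less.prems(5)[of F] by blast
    have "finite D" using D(1) fin by (rule finite_subset)
    then have cardFD: "card (F - D) = card F - d"
      using card_Diff_subset[OF _ D(1)] D(2) by simp
    define m where "m = real (card (F - D))"
    define e where "e = real (card (intersecting_pairs (F - D)))"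
    have n: "real (card F) = m + real d" using cardFD True by (simp add: m_def)
    have "2 * real d * e \<le> (real d - 1) * m\<^sup>2 + 2 * (real k - 1) * m"
      unfolding e_def m_def
    proof (rule less.hyps)
      show "card (F - D) < card F" using cardFD True less.prems(3) by linarith
      show "\<exists>D\<subseteq>H. card D = d \<and> intersecting {A \<in> H. \<forall>B\<in>D. A \<inter> B \<noteq> {}}"
        if "H \<subseteq> F - D" "d \<le> card H" for H
        using less.prems(5)[of H] that by blast
      show "card G \<le> k" if "G \<subseteq> F - D" "intersecting G" for G
        using less.prems(6)[of G] that by blast
    qed (use less.prems in auto)
    moreover have "real (card (intersecting_pairs F))
        \<le> e + real d * (real d - 1) / 2 + m * (real d - 1) + (real k - 1)"
    proof -
      have "real (card (intersecting_pairs F) + 1)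
          \<le> real (card (intersecting_pairs (F - D)) + (d choose 2) + card (F - D) * (d - 1) + k)"
        using card_pairs_peel[OF fin less.prems(2) D(1,2) less.prems(3) D(3) less.prems(6)]
        unfolding cardFD by (intro of_nat_mono) blast
      then show ?thesis
        using less.prems(3) choose2[of d] by (simp add: e_def m_def of_nat_diff)
    qed
    then have "2 * real d * real (card (intersecting_pairs F))
        \<le> 2 * real d * (e + real d * (real d - 1) / 2 + m * (real d - 1) + (real k - 1))"
      by (intro mult_left_mono) auto
    ultimately show ?thesis
      unfolding n by (simp add: field_simps power2_eq_square)
  qed
qed

section \<open>The fractional Helly theorem for boxes\<close>

theorem corollary1:
  fixes F :: "(real ^ 'd) set set" and n :: nat and \<epsilon> :: real
  assumes "\<epsilon> > 0"
    and "n \<ge> 1"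
    and "finite F" and "card F = n"
    and "box_family F"
    and "real (card (intersecting_pairs F))
           \<ge> ((real CARD('d) - 1) / (2 * real CARD('d)) + \<epsilon>) * (real n)\<^sup>2"
  shows "\<exists>G. G \<subseteq> F \<and> intersecting G
           \<and> real (card G) \<ge> real CARD('d) * real n * \<epsilon> - real CARD('d) / 2 + 1"
proof -
  let ?d = "CARD('d)"
  define K where "K = card ` {G. G \<subseteq> F \<and> intersecting G}"
  have finK: "finite K" using assms(3) by (simp add: K_def)
  have ne: "{} \<notin> F" using box_family_nonempty[OF assms(5)] by blast
  obtain B x where B: "B \<in> F" "x \<in> B"
    using assms(2,4) ne by (metis card.empty equals0I not_one_le_zero)
  have one: "1 \<in> K"
    unfolding K_def using B by (intro image_eqI[of _ _ "{B}"]) (auto simp: intersecting_def)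
  then have "Max K \<in> K" using finK by (intro Max_in) auto
  then obtain G where G: "G \<subseteq> F" "intersecting G" "card G = Max K" by (auto simp: K_def)
  have sub: "box_family H" if "H \<subseteq> F" for H
    using assms(5) that unfolding box_family_def by blast
  have bound: "2 * real ?d * real (card (intersecting_pairs F))
      \<le> (real ?d - 1) * (real n)\<^sup>2 + 2 * (real (card G) - 1) * real n"
    unfolding assms(4)[symmetric]
  proof (rule card_pairs_bound[OF assms(3) ne])
    show "1 \<le> card G" using Max_ge[OF finK one] G(3) by simp
    show "\<exists>D\<subseteq>H. card D = ?d \<and> intersecting {A \<in> H. \<forall>B\<in>D. A \<inter> B \<noteq> {}}"
      if "H \<subseteq> F" "?d \<le> card H" for H
      using boxes_meeting_transversal[OF finite_subset[OF that(1) assms(3)] that(2) sub[OF that(1)]] .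
    show "card G' \<le> card G" if "G' \<subseteq> F" "intersecting G'" for G'
      unfolding G(3) using finK that by (intro Max_ge) (auto simp: K_def)
  qed simp
  have "(real ?d - 1) * (real n)\<^sup>2 + 2 * (real ?d * real n * \<epsilon>) * real n
      = 2 * real ?d * (((real ?d - 1) / (2 * real ?d) + \<epsilon>) * (real n)\<^sup>2)"
    by (simp add: field_simps power2_eq_square)
  also have "\<dots> \<le> 2 * real ?d * real (card (intersecting_pairs F))"
    using assms(6) by (intro mult_left_mono) auto
  finally have "(real ?d * real n * \<epsilon>) * real n \<le> (real (card G) - 1) * real n"
    using bound by linarith
  then have "real ?d * real n * \<epsilon> \<le> real (card G) - 1"
    using assms(2) by (simp add: mult.assoc mult.commute[of \<epsilon>])
  then have "real ?d * real n * \<epsilon> - real ?d / 2 + 1 \<le> real (card G)"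
    by (simp add: field_simps)
  then show ?thesis using G by blast
qed

end
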